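(* Let $n,t\ge1$ be integers with $n>2^{18}$ and $t\le\frac{n}{64\log_2 n}$. Let $\mathcal{F}\subset\Sigma_n$ be a $t$-intersecting family of permutations, and put $q=4t\log_2 n$. Then there exist a $t$-intersecting family $\mathcal{S}$ of partial permutations, each of size at most $q$, and a family $\mathcal{F}'\subset\mathcal{F}$ such that: (i) every permutation in $\mathcal{F}\setminus\mathcal{F}'$ contains some member of $\mathcal{S}$; (ii) for every $B\in\mathcal{S}$ there is a family $\mathcal{F}_B\subset\mathcal{F}$ such that $\mathcal{F}_B(B)$ is $(\Sigma_n(B),2)$-homogeneous; (iii) $|\mathcal{F}'|\le n^{-4t}\, n!$.
   Context: Each permutation $\sigma$ of $[n]$ is identified with its graph $\{(1,\sigma(1)),\dots,(n,\sigma(n))\}\subset[n]^2$, so $\Sigma_n\subset\binom{[n]^2}{n}$ and intersections of permutations are intersections of these sets. A partial permutation is a set $S\subset[n]^2$ contained in the graph of some permutation. A family is $t$-intersecting if any two of its members share at least $t$ elements. For a family $\mathcal{G}$ and a set $S$, $\mathcal{G}(S)=\{A\setminus S: A\in\mathcal{G},\ S\subset A\}$. For families $\mathcal{G}\subset\mathcal{B}$ and $\tau>1$, $\mathcal{G}$ is $(\mathcal{B},\tau)$-homogeneous if for every set $S$, $\frac{|\mathcal{G}(S)|}{|\mathcal{G}|}\le\tau^{|S|}\frac{|\mathcal{B}(S)|}{|\mathcal{B}|}$. *)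

theory Defs
  imports Complex_Main "HOL-Combinatorics.Permutations"
begin

definition perm_graph :: "nat \<Rightarrow> (nat \<Rightarrow> nat) \<Rightarrow> (nat \<times> nat) set" where
  "perm_graph n \<sigma> = {(i, \<sigma> i) | i. i \<in> {1..n}}"

definition perms :: "nat \<Rightarrow> (nat \<times> nat) set set" where
  "perms n = perm_graph n ` {\<sigma>. \<sigma> permutes {1..n}}"

definition partial_perm :: "nat \<Rightarrow> (nat \<times> nat) set \<Rightarrow> bool" where
  "partial_perm n S \<longleftrightarrow> (\<exists>A\<in>perms n. S \<subseteq> A)"

text \<open>The two members are not required to be distinct; in particular every member of a
  \<open>t\<close>-intersecting family has at least \<open>t\<close> elements.\<close>

definition t_intersecting :: "nat \<Rightarrow> 'a set set \<Rightarrow> bool" where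
  "t_intersecting t \<F> \<longleftrightarrow> (\<forall>A\<in>\<F>. \<forall>B\<in>\<F>. t \<le> card (A \<inter> B))"

definition link :: "'a set set \<Rightarrow> 'a set \<Rightarrow> 'a set set" where
  "link \<G> S = {A - S | A. A \<in> \<G> \<and> S \<subseteq> A}"

text \<open>The families are finite and \<open>\<G>\<close> is nonempty, so that the quotients are the intended
  ones: otherwise the convention \<open>x / 0 = 0\<close> would make the empty family homogeneous.\<close>

definition homogeneous :: "'a set set \<Rightarrow> real \<Rightarrow> 'a set set \<Rightarrow> bool" where
  "homogeneous \<B> \<tau> \<G> \<longleftrightarrow>
     finite \<B> \<and> \<G> \<subseteq> \<B> \<and> \<G> \<noteq> {} \<and> \<tau> > 1 \<and>
     (\<forall>S. real (card (link \<G> S)) / real (card \<G>)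
            \<le> \<tau> ^ card S * (real (card (link \<B> S)) / real (card \<B>)))"

end

theory Submission
  imports Defs "HOL-Library.FuncSet"
begin

text \<open>
  Take for \<open>\<S>\<close> all partial permutations \<open>B\<close> of size at most \<open>q\<close> that admit a suitable
  \<open>\<F>\<^sub>B\<close>, and for \<open>\<F>'\<close> the members of \<open>\<F>\<close> containing none of them. A maximal set \<open>S\<close> on which
  \<open>\<F>'\<close> has at least \<open>2 ^ card S\<close> times the expected density has a homogeneous link, hence
  \<open>card S > q\<close>, and the density of \<open>\<F>'\<close> is at most \<open>2 powr - q\<close>.

  For the intersection property, a homogeneous link is spread: a set \<open>T\<close> is contained in at most a
  fraction \<open>R ^ (- card T)\<close> of its members, with \<open>R\<close> linear in \<open>n\<close>. Two such families
  contain disjoint members: colour the ground set uniformly with \<open>2 L\<close> colours, where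
  \<open>2 ^ L > n\<close>. Revealing the first \<open>L\<close> colour classes one at a time, the part of a member left
  uncovered can be halved at each step (in the style of Alweiss, Lovett, Wu and Zhang), so with
  probability at least \<open>3/4\<close> these classes contain a member of the first family; likewise for
  the last \<open>L\<close> classes and the second family. So members of \<open>\<F>\<close> exist that meet exactly in
  \<open>B \<inter> B'\<close>.
\<close>

section \<open>Spread families and colourings of the ground set\<close>

definition spread :: "real \<Rightarrow> 'a set set \<Rightarrow> bool" where
  "spread R \<G> \<longleftrightarrow> (\<forall>T. finite T \<longrightarrow> real (card {A \<in> \<G>. T \<subseteq> A}) * R ^ card T \<le> real (card \<G>))"

text \<open>The witness \<open>A'\<close> may differ from \<open>A\<close>, but what
  \<open>Y\<close> leaves uncovered of it lies in \<open>A\<close>. This is what lets spreadness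
  limit the number of such \<open>A\<close>.\<close>

definition covered :: "'a set set \<Rightarrow> nat \<Rightarrow> 'a set \<Rightarrow> 'a set \<Rightarrow> bool" where
  "covered \<G> k Y A \<longleftrightarrow> (\<exists>A'\<in>\<G>. A' \<subseteq> A \<union> Y \<and> card (A' - Y) \<le> k)"

text \<open>Limits how many colourings can give the same colouring when the points of one set
  \<open>B\<close> are recoloured.\<close>

lemma card_PiE_agree_outside_le:
  fixes X :: "'a set" and c :: "'a \<Rightarrow> nat"
  assumes "finite B" and "K > 0"
  shows "finite {c' \<in> X \<rightarrow>\<^sub>E {..<K}. \<forall>x. x \<notin> B \<longrightarrow> c' x = c x}" (is "finite ?D")
    and "card {c' \<in> X \<rightarrow>\<^sub>E {..<K}. \<forall>x. x \<notin> B \<longrightarrow> c' x = c x} \<le> K ^ card B"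
proof -
  have inj: "inj_on (\<lambda>c'. restrict c' (B \<inter> X)) ?D"
  proof (rule inj_onI, rule ext)
    fix f g x
    assume f: "f \<in> ?D" and g: "g \<in> ?D" and eq: "restrict f (B \<inter> X) = restrict g (B \<inter> X)"
    show "f x = g x"
    proof (cases "x \<in> B \<inter> X")
      case True
      then show ?thesis using fun_cong[OF eq, of x] by simp
    next
      case False
      then show ?thesis using f g by (auto simp: PiE_def extensional_def)
    qed
  qed
  have sub: "(\<lambda>c'. restrict c' (B \<inter> X)) ` ?D \<subseteq> (B \<inter> X) \<rightarrow>\<^sub>E {..<K}"
    by (intro image_subsetI) (simp add: restrict_PiE_iff PiE_iff)
  have fin: "finite ((B \<inter> X) \<rightarrow>\<^sub>E {..<K})"
    using assms by (intro finite_PiE) auto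
  show "finite ?D" using inj sub fin by (rule inj_on_finite)
  have "card ?D \<le> card ((B \<inter> X) \<rightarrow>\<^sub>E {..<K})"
    using inj sub fin by (rule card_inj_on_le)
  also have "\<dots> = K ^ card (B \<inter> X)"
    using assms by (simp add: card_PiE)
  also have "\<dots> \<le> K ^ card B"
    using assms by (intro power_increasing card_mono) auto
  finally show "card ?D \<le> K ^ card B" .
qed

lemma card_UN_le_mult:
  fixes b :: real
  assumes "finite I" and "\<And>i. i \<in> I \<Longrightarrow> real (card (F i)) \<le> b"
  shows "real (card (\<Union>i\<in>I. F i)) \<le> real (card I) * b"
proof -
  have "real (card (\<Union>i\<in>I. F i)) \<le> real (\<Sum>i\<in>I. card (F i))"
    using card_UN_le[OF assms(1)] by (rule of_nat_mono)
  also have "\<dots> = (\<Sum>i\<in>I. real (card (F i)))" by simp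
  also have "\<dots> \<le> real (card I) * b"
    using assms(2) by (rule sum_bounded_above)
  finally show ?thesis .
qed

text \<open>A colouring \<open>c\<close> counted here is recovered from its recolouring \<open>c'\<close>, in which a witness
  \<open>B \<subseteq> A\<close> of \<open>covered\<close> for the first \<open>i\<close> classes is moved into class \<open>i\<close>. A member \<open>M\<close> of
  \<open>\<G>\<close> inside the first \<open>i + 1\<close> classes of \<open>c'\<close> exists and can be chosen from \<open>c'\<close> alone;
  the part \<open>T\<close> of \<open>M\<close> outside those classes of \<open>c\<close> lies in \<open>A\<close> and has more than \<open>k'\<close> elements,
  so that spreadness makes \<open>A\<close> rare.\<close>

lemma card_lose_cover_le:
  fixes X :: "'a set" and h :: "nat \<Rightarrow> nat"
  assumes X: "finite X" and GX: "\<G> \<subseteq> Pow X" and K: "K > 0"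
    and R: "R \<ge> 1" and spread: "spread R \<G>"
    and hi: "h i < K" "h i \<notin> h ` {..<i}"
  defines "Y \<equiv> \<lambda>j c. {x \<in> X. c x \<in> h ` {..<j}}"
  shows "real (card {(c, A). c \<in> X \<rightarrow>\<^sub>E {..<K} \<and> A \<in> \<G> \<and> covered \<G> k (Y i c) A
            \<and> \<not> covered \<G> k' (Y (Suc i) c) A})
    \<le> real (card (X \<rightarrow>\<^sub>E {..<K})) * (2 ^ k * (real (card \<G>) / R ^ Suc k' * real K ^ k))"
    (is "real (card ?Bad) \<le> _")
proof -
  let ?C = "X \<rightarrow>\<^sub>E {..<K}"
  have finC: "finite ?C" using X by (intro finite_PiE) auto
  have finG: "finite \<G>" using GX X by (meson finite_Pow_iff finite_subset)
  have finm: "finite A" if "A \<in> \<G>" for A using that GX X by (meson PowD finite_subset subsetD)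
  define wit where "wit = (\<lambda>Z A B. \<exists>A'\<in>\<G>. A' \<subseteq> A \<union> Z \<and> card (A' - Z) \<le> k \<and> B = A' - Z)"
  \<comment> \<open>The witness depends on \<open>Z\<close> and \<open>A\<close> only. The
    recoloured set avoids \<open>Y i c\<close>, and \<open>h i\<close> is a colour not yet revealed,
    so \<open>Y i\<close> is the same for \<open>c\<close> and \<open>c'\<close>. Hence
    \<open>c'\<close> and \<open>A\<close> determine the set outside of which \<open>c\<close> and
    \<open>c'\<close> agree.\<close>
  define \<beta> where "\<beta> = (\<lambda>Z A. SOME B. wit Z A B)"
  have wit_\<beta>: "wit Z A (\<beta> Z A)" if "covered \<G> k Z A" for Z A
  proof -
    have "\<exists>B. wit Z A B" using that unfolding wit_def covered_def by blast
    then show ?thesis unfolding \<beta>_def by (rule someI_ex)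
  qed
  define cand where "cand = (\<lambda>c M. M \<in> \<G> \<and> M \<subseteq> Y (Suc i) c \<and> card (M - Y i c) \<le> k)"
  define \<mu> where "\<mu> = (\<lambda>c. SOME M. cand c M)"
  define TT where "TT = (\<lambda>c. if cand c (\<mu> c) then {T \<in> Pow (\<mu> c - Y i c). k' < card T} else {})"
  define D where "D = (\<lambda>c A. if covered \<G> k (Y i c) A
      then {c' \<in> ?C. \<forall>x. x \<notin> \<beta> (Y i c) A \<longrightarrow> c' x = c x} else {})"
  \<comment> \<open>The order of the unions is the order of the count: first \<open>c'\<close>; then
    a subset \<open>T\<close> of the chosen member's uncovered part, at most \<open>2 ^ k\<close>
    choices; then \<open>A\<close> containing \<open>T\<close>, limited by spreadness; last the old
    colours on the witness, at most \<open>K ^ k\<close> choices.\<close>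
  have sub: "?Bad \<subseteq> (\<Union>c\<in>?C. \<Union>T\<in>TT c. \<Union>A\<in>{A\<in>\<G>. T \<subseteq> A}. (\<lambda>c'. (c', A)) ` D c A)"
  proof clarify
    fix c A
    assume c: "c \<in> ?C" and A: "A \<in> \<G>" and cov: "covered \<G> k (Y i c) A"
      and ncov: "\<not> covered \<G> k' (Y (Suc i) c) A"
    define B where "B = \<beta> (Y i c) A"
    obtain A' where A': "A' \<in> \<G>" "A' \<subseteq> A \<union> Y i c" "card (A' - Y i c) \<le> k" "B = A' - Y i c"
      using wit_\<beta>[OF cov] by (auto simp: wit_def B_def)
    have BX: "B \<subseteq> X" using A' GX by auto
    define c' where "c' = (\<lambda>x. if x \<in> B then h i else c x)"
    have c': "c' \<in> ?C" using c hi BX by (auto simp: c'_def PiE_def extensional_def)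
    have Yi: "Y i c' = Y i c" using A' hi by (auto simp: Y_def c'_def)
    have YS: "Y (Suc i) c' = Y (Suc i) c \<union> B" using BX by (auto simp: Y_def c'_def lessThan_Suc)
    have YiS: "Y i c \<subseteq> Y (Suc i) c" by (auto simp: Y_def lessThan_Suc)
    have "cand c' A'" using A' YS Yi YiS by (auto simp: cand_def)
    then have cand: "cand c' (\<mu> c')" unfolding \<mu>_def by (rule someI)
    \<comment> \<open>The member \<open>\<mu> c'\<close> lies in
      \<open>Y (Suc i) c \<union> B\<close>, so this part of it lies in \<open>B\<close> and hence
      in \<open>A\<close>. If it were small, \<open>\<mu> c'\<close> would itself witness that
      \<open>A\<close> is still covered.\<close>
    define T where "T = \<mu> c' - Y (Suc i) c"
    have TB: "T \<subseteq> B" using cand YS by (auto simp: cand_def T_def)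
    have TA: "T \<subseteq> A" using TB A' by auto
    have "k' < card T"
    proof (rule ccontr)
      assume "\<not> k' < card T"
      then have "covered \<G> k' (Y (Suc i) c) A"
        unfolding covered_def using cand TA by (intro bexI[of _ "\<mu> c'"]) (auto simp: T_def cand_def)
      then show False using ncov by simp
    qed
    then have T: "T \<in> TT c'" using cand YiS Yi by (auto simp: TT_def T_def)
    have "c \<in> D c' A" using c cov Yi by (auto simp: D_def c'_def B_def)
    then show "(c, A) \<in> (\<Union>c\<in>?C. \<Union>T\<in>TT c. \<Union>A\<in>{A\<in>\<G>. T \<subseteq> A}. (\<lambda>c'. (c', A)) ` D c A)"
      using c' T A TA by blast
  qed
  have D: "finite (D c A)" "real (card (D c A)) \<le> real K ^ k" if "A \<in> \<G>" for c A
  proof -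
    have "finite (D c A) \<and> card (D c A) \<le> K ^ k"
    proof (cases "covered \<G> k (Y i c) A")
      case True
      then have B: "finite (\<beta> (Y i c) A)" "card (\<beta> (Y i c) A) \<le> k"
        using wit_\<beta>[OF True] finm by (auto simp: wit_def)
      have "K ^ card (\<beta> (Y i c) A) \<le> K ^ k" using B K by (intro power_increasing) auto
      then show ?thesis using card_PiE_agree_outside_le[OF B(1) K, of X c] True
        by (auto simp: D_def)
    qed (simp add: D_def)
    then show "finite (D c A)" "real (card (D c A)) \<le> real K ^ k"
      by (auto simp flip: of_nat_power)
  qed
  have TT: "finite (TT c)" "card (TT c) \<le> 2 ^ k" "\<And>T. T \<in> TT c \<Longrightarrow> finite T \<and> k' < card T" for c
  proof -
    have *: "finite (TT c) \<and> card (TT c) \<le> 2 ^ k \<and> (\<forall>T\<in>TT c. finite T \<and> k' < card T)"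
    proof (cases "cand c (\<mu> c)")
      case True
      then have fin: "finite (\<mu> c - Y i c)" using finm by (auto simp: cand_def)
      have "card (TT c) \<le> card (Pow (\<mu> c - Y i c))"
        using fin by (intro card_mono) (auto simp: TT_def)
      also have "\<dots> = 2 ^ card (\<mu> c - Y i c)" using fin by (rule card_Pow)
      also have "\<dots> \<le> 2 ^ k" using True by (intro power_increasing) (auto simp: cand_def)
      finally show ?thesis using fin True by (auto simp: TT_def intro: finite_subset)
    qed (simp add: TT_def)
    then show "finite (TT c)" "card (TT c) \<le> 2 ^ k" "\<And>T. T \<in> TT c \<Longrightarrow> finite T \<and> k' < card T"
      by auto
  qed
  have sp: "real (card {A\<in>\<G>. T \<subseteq> A}) \<le> real (card \<G>) / R ^ Suc k'" if "T \<in> TT c" for T c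
  proof -
    have "real (card {A\<in>\<G>. T \<subseteq> A}) * R ^ Suc k' \<le> real (card {A\<in>\<G>. T \<subseteq> A}) * R ^ card T"
      using R TT(3)[OF that] by (intro mult_left_mono power_increasing) auto
    also have "\<dots> \<le> real (card \<G>)" using spread TT(3)[OF that] by (auto simp: spread_def)
    finally show ?thesis using R by (simp add: field_simps)
  qed
  have 1: "real (card (\<Union>A\<in>{A\<in>\<G>. T \<subseteq> A}. (\<lambda>c'. (c', A)) ` D c A))
      \<le> real (card \<G>) / R ^ Suc k' * real K ^ k" if "T \<in> TT c" for T c
  proof -
    have "real (card (\<Union>A\<in>{A\<in>\<G>. T \<subseteq> A}. (\<lambda>c'. (c', A)) ` D c A))
      \<le> real (card {A\<in>\<G>. T \<subseteq> A}) * real K ^ k"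
    proof (rule card_UN_le_mult)
      fix A assume "A \<in> {A\<in>\<G>. T \<subseteq> A}"
      then have A: "A \<in> \<G>" by simp
      have "card ((\<lambda>c'. (c', A)) ` D c A) \<le> card (D c A)" by (rule card_image_le[OF D(1)[OF A]])
      then show "real (card ((\<lambda>c'. (c', A)) ` D c A)) \<le> real K ^ k"
        using D(2)[OF A, of c] by linarith
    qed (use finG in auto)
    also have "\<dots> \<le> real (card \<G>) / R ^ Suc k' * real K ^ k"
      using sp[OF that] by (intro mult_right_mono) auto
    finally show ?thesis .
  qed
  have 2: "real (card (\<Union>T\<in>TT c. \<Union>A\<in>{A\<in>\<G>. T \<subseteq> A}. (\<lambda>c'. (c', A)) ` D c A))
      \<le> 2 ^ k * (real (card \<G>) / R ^ Suc k' * real K ^ k)" for c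
  proof -
    have "real (card (\<Union>T\<in>TT c. \<Union>A\<in>{A\<in>\<G>. T \<subseteq> A}. (\<lambda>c'. (c', A)) ` D c A))
      \<le> real (card (TT c)) * (real (card \<G>) / R ^ Suc k' * real K ^ k)"
      using TT(1) 1 by (rule card_UN_le_mult)
    also have "\<dots> \<le> 2 ^ k * (real (card \<G>) / R ^ Suc k' * real K ^ k)"
    proof (rule mult_right_mono)
      show "real (card (TT c)) \<le> 2 ^ k" using of_nat_mono[OF TT(2)[of c], where 'a=real] by simp
    qed (use R in auto)
    finally show ?thesis .
  qed
  have "card ?Bad \<le> card (\<Union>c\<in>?C. \<Union>T\<in>TT c. \<Union>A\<in>{A\<in>\<G>. T \<subseteq> A}. (\<lambda>c'. (c', A)) ` D c A)"
    using sub by (rule card_mono[rotated]) (use finC TT(1) finG D(1) in auto)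
  also have "real \<dots> \<le> real (card ?C) * (2 ^ k * (real (card \<G>) / R ^ Suc k' * real K ^ k))"
    using finC 2 by (rule card_UN_le_mult)
  finally show ?thesis by simp
qed

text \<open>If the first \<open>L\<close> classes of \<open>c\<close> contain no member, then for
  every \<open>A\<close> the cover is lost at some step \<open>i < L\<close>. So the pairs of such a
  \<open>c\<close> with an arbitrary \<open>A\<close> are counted by \<open>L\<close> applications
  of the previous bound, and dividing by \<open>card \<G>\<close> leaves the colourings.\<close>

lemma card_colourings_without_member_le:
  fixes X :: "'a set" and h :: "nat \<Rightarrow> nat"
  assumes X: "finite X" and GX: "\<G> \<subseteq> Pow X" and ne: "\<G> \<noteq> {}"
    and size: "\<And>A. A \<in> \<G> \<Longrightarrow> card A < 2 ^ L" and K: "K > 0"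
    and R: "R \<ge> 4 * real K ^ 2" and spread: "spread R \<G>"
    and h: "inj_on h {..<L}" "h ` {..<L} \<subseteq> {..<K}"
  shows "real (card {c \<in> X \<rightarrow>\<^sub>E {..<K}. \<forall>A\<in>\<G>. \<not> A \<subseteq> {x. c x \<in> h ` {..<L}}})
    \<le> real (card (X \<rightarrow>\<^sub>E {..<K})) * (real L / (2 * real K))" (is "real (card ?N) \<le> _")
proof -
  let ?C = "X \<rightarrow>\<^sub>E {..<K}"
  define Y where "Y = (\<lambda>j c. {x \<in> X. c x \<in> h ` {..<j}})"
  \<comment> \<open>At \<open>i = 0\<close> the bound admits every member, uncovered entirely; at
    \<open>i = L\<close> it is 0, so a cover is a member inside the revealed classes.\<close>
  define k where "k = (\<lambda>i::nat. (2 ^ L - 1) div 2 ^ i :: nat)"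
  define Bad where "Bad = (\<lambda>i. {(c, A). c \<in> ?C \<and> A \<in> \<G> \<and> covered \<G> (k i) (Y i c) A
            \<and> \<not> covered \<G> (k (Suc i)) (Y (Suc i) c) A})"
  have finC: "finite ?C" using X by (intro finite_PiE) auto
  have finG: "finite \<G>" using GX X by (meson finite_Pow_iff finite_subset)
  have finm: "finite A" if "A \<in> \<G>" for A using that GX X by (meson PowD finite_subset subsetD)
  have K1: "real K \<ge> 1" using K by simp
  have "real K ^ 2 \<ge> 1" using K1 by (rule one_le_power)
  then have R1: "R \<ge> 1" using R by linarith
  have sub: "?N \<times> \<G> \<subseteq> (\<Union>i\<in>{..<L}. Bad i)"
  proof clarify
    fix c A
    assume c: "c \<in> ?C" and nA: "\<forall>A\<in>\<G>. \<not> A \<subseteq> {x. c x \<in> h ` {..<L}}" and A: "A \<in> \<G>"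
    have 0: "covered \<G> (k 0) (Y 0 c) A"
      using A size[OF A] by (auto simp: covered_def k_def Y_def)
    have "\<not> covered \<G> (k L) (Y L c) A"
    proof
      assume "covered \<G> (k L) (Y L c) A"
      then obtain A' where A': "A' \<in> \<G>" "card (A' - Y L c) = 0"
        by (auto simp: covered_def k_def)
      then have "A' \<subseteq> Y L c" using finm[OF A'(1)] by simp
      then show False using nA A' by (auto simp: Y_def)
    qed
    with 0 have "\<exists>i<L. covered \<G> (k i) (Y i c) A \<and> \<not> covered \<G> (k (Suc i)) (Y (Suc i) c) A"
      using ex_least_nat_less[of "\<lambda>i. \<not> covered \<G> (k i) (Y i c) A" L] by auto
    then show "(c, A) \<in> (\<Union>i\<in>{..<L}. Bad i)" using c A by (auto simp: Bad_def)
  qed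
  have bad: "real (card (Bad i)) \<le> real (card ?C) * (real (card \<G>) / (2 * real K))"
    if i: "i < L" for i
  proof -
    have hi: "h i < K" "h i \<notin> h ` {..<i}"
      using h i by (auto dest!: inj_onD[OF h(1), of i])
    have ks: "k i \<le> 2 * k (Suc i) + 1"
    proof -
      have "k (Suc i) = k i div 2" unfolding k_def power_Suc2 by (rule div_mult2_eq)
      then show ?thesis by linarith
    qed
    \<comment> \<open>The \<open>2 ^ k * K ^ k\<close> choices of one step must be paid for by
      \<open>R\<close> to the power \<open>k (Suc i) + 1\<close>. As halving gives
      \<open>k i + 1 \<le> 2 * (k (Suc i) + 1)\<close>, the value \<open>4 * K ^ 2\<close> suffices
      and leaves a factor \<open>2 * K\<close> to spare.\<close>
    have "(2 * real K) ^ k i * (2 * real K) \<le> (2 * real K) ^ (2 * k (Suc i) + 1) * (2 * real K)"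
      using ks K1 by (intro mult_right_mono power_increasing) auto
    also have "\<dots> = (4 * real K ^ 2) ^ Suc (k (Suc i))"
    proof -
      have "(2 * real K) ^ (2 * k (Suc i) + 1) * (2 * real K) = (2 * real K) ^ (2 * Suc (k (Suc i)))"
        by simp
      also have "\<dots> = ((2 * real K) ^ 2) ^ Suc (k (Suc i))" by (rule power_mult)
      finally show ?thesis by (simp add: power_mult_distrib)
    qed
    also have "\<dots> \<le> R ^ Suc (k (Suc i))" using R by (intro power_mono) auto
    finally have le: "(2 * real K) ^ k i / R ^ Suc (k (Suc i)) \<le> 1 / (2 * real K)"
      using R1 K1 by (simp add: divide_simps mult.commute)
    have "real (card (Bad i)) \<le> real (card ?C) *
        (2 ^ k i * (real (card \<G>) / R ^ Suc (k (Suc i)) * real K ^ k i))"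
      unfolding Bad_def Y_def using X GX K R1 spread hi by (rule card_lose_cover_le)
    also have "\<dots> = real (card ?C) * (real (card \<G>) * ((2 * real K) ^ k i / R ^ Suc (k (Suc i))))"
      by (simp add: power_mult_distrib)
    also have "\<dots> \<le> real (card ?C) * (real (card \<G>) * (1 / (2 * real K)))"
      using le by (intro mult_left_mono) auto
    finally show ?thesis by simp
  qed
  have fin: "finite (Bad i)" for i
    using finC finG by (rule_tac finite_subset[of _ "?C \<times> \<G>"]) (auto simp: Bad_def)
  have "real (card ?N) * real (card \<G>) = real (card (?N \<times> \<G>))"
    by (simp add: card_cartesian_product)
  also have "\<dots> \<le> real (card (\<Union>i\<in>{..<L}. Bad i))"
    using sub fin by (intro of_nat_mono card_mono) auto
  also have "\<dots> \<le> real (card {..<L}) * (real (card ?C) * (real (card \<G>) / (2 * real K)))"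
    using bad by (intro card_UN_le_mult) auto
  also have "\<dots> = real (card ?C) * (real L / (2 * real K)) * real (card \<G>)" by simp
  finally show ?thesis
    by (rule mult_right_le_imp_le) (use ne finG in \<open>simp add: card_gt_0_iff\<close>)
qed

lemma spread_families_disjoint_members:
  fixes X :: "'a set"
  assumes X: "finite X" and GX: "\<G> \<subseteq> Pow X" "\<H> \<subseteq> Pow X" and ne: "\<G> \<noteq> {}" "\<H> \<noteq> {}"
    and size: "\<And>A. A \<in> \<G> \<union> \<H> \<Longrightarrow> card A < 2 ^ L" and L: "L > 0"
    and R: "R \<ge> 16 * real L ^ 2" and spread: "spread R \<G>" "spread R \<H>"
  obtains A B where "A \<in> \<G>" "B \<in> \<H>" "A \<inter> B = {}"
proof -
  let ?C = "X \<rightarrow>\<^sub>E {..<2 * L}"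
  let ?N = "\<lambda>\<G> h. {c \<in> ?C. \<forall>A\<in>\<G>. \<not> A \<subseteq> {x. c x \<in> h ` {..<L}}}"
  have finC: "finite ?C" using X by (intro finite_PiE) auto
  have R': "R \<ge> 4 * real (2 * L) ^ 2" using R by (simp add: power_mult_distrib)
  \<comment> \<open>\<open>id\<close> and \<open>(+) L\<close> enumerate the two halves of the
    colours. Each bad set has at most a quarter of all colourings, so some colouring is good for
    both families.\<close>
  have "real (card (?N \<G> id)) \<le> real (card ?C) * (real L / (2 * real (2 * L)))"
    using X GX(1) ne(1) size _ R' spread(1)
    by (rule card_colourings_without_member_le) (use L in auto)
  moreover have "real (card (?N \<H> ((+) L))) \<le> real (card ?C) * (real L / (2 * real (2 * L)))"
    using X GX(2) ne(2) size _ R' spread(2)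
    by (rule card_colourings_without_member_le) (use L in auto)
  moreover have "card (?N \<G> id \<union> ?N \<H> ((+) L)) \<le> card (?N \<G> id) + card (?N \<H> ((+) L))"
    by (rule card_Un_le)
  moreover have "card ?C > 0" using L X by (simp add: card_PiE)
  ultimately have "card (?N \<G> id \<union> ?N \<H> ((+) L)) < card ?C" using L by simp
  then have "\<not> ?C \<subseteq> ?N \<G> id \<union> ?N \<H> ((+) L)"
    using finC by (metis (no_types, lifting) card_mono finite_subset finite_Un mem_Collect_eq not_le subsetI)
  then obtain c A B where "A \<in> \<G>" "B \<in> \<H>" "A \<subseteq> {x. c x \<in> id ` {..<L}}"
      "B \<subseteq> {x. c x \<in> (+) L ` {..<L}}"
    by blast
  then show thesis by (intro that[of A B]) force+
qed

section \<open>Restricting a spread family\<close>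

lemma spread_mono:
  assumes "spread R \<G>" "0 \<le> R'" "R' \<le> R"
  shows "spread R' \<G>"
  unfolding spread_def
proof (intro allI impI)
  fix T :: "'a set"
  assume "finite T"
  have "real (card {A \<in> \<G>. T \<subseteq> A}) * R' ^ card T \<le> real (card {A \<in> \<G>. T \<subseteq> A}) * R ^ card T"
    using assms by (intro mult_left_mono power_mono) auto
  also have "\<dots> \<le> real (card \<G>)"
    using assms(1) \<open>finite T\<close> by (auto simp: spread_def)
  finally show "real (card {A \<in> \<G>. T \<subseteq> A}) * R' ^ card T \<le> real (card \<G>)" .
qed

text \<open>Spreadness at singletons shows that each point of \<open>B\<close> lies in at most a
  fraction \<open>1 / R\<close> of the members, so at least half of them avoid \<open>B\<close>. For
  nonempty \<open>T\<close> the lost factor 2 is absorbed by \<open>2 ^ card T\<close>.\<close>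

lemma spread_avoiding:
  assumes G: "finite \<G>" "\<G> \<noteq> {}" and spread: "spread R \<G>"
    and B: "finite B" "2 * real (card B) \<le> R" and R: "R > 0"
  shows "{A \<in> \<G>. A \<inter> B = {}} \<noteq> {}" (is "?H \<noteq> {}") and "spread (R / 2) {A \<in> \<G>. A \<inter> B = {}}"
proof -
  have "real (card (\<Union>x\<in>B. {A \<in> \<G>. {x} \<subseteq> A})) \<le> real (card B) * (real (card \<G>) / R)"
  proof (rule card_UN_le_mult[OF B(1)])
    fix x
    have "real (card {A \<in> \<G>. {x} \<subseteq> A}) * R ^ card {x} \<le> real (card \<G>)"
      using spread unfolding spread_def by blast
    then show "real (card {A \<in> \<G>. {x} \<subseteq> A}) \<le> real (card \<G>) / R"
      using R by (simp add: field_simps)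
  qed
  also have "\<dots> \<le> real (card \<G>) / 2"
    using mult_right_mono[OF B(2), of "real (card \<G>)"] R by (simp add: field_simps)
  finally have hit: "real (card (\<Union>x\<in>B. {A \<in> \<G>. {x} \<subseteq> A})) \<le> real (card \<G>) / 2" .
  have "\<G> \<subseteq> ?H \<union> (\<Union>x\<in>B. {A \<in> \<G>. {x} \<subseteq> A})" by auto
  then have "card \<G> \<le> card (?H \<union> (\<Union>x\<in>B. {A \<in> \<G>. {x} \<subseteq> A}))"
    using G B by (intro card_mono) auto
  also have "\<dots> \<le> card ?H + card (\<Union>x\<in>B. {A \<in> \<G>. {x} \<subseteq> A})" by (rule card_Un_le)
  finally have half: "real (card \<G>) \<le> 2 * real (card ?H)" using hit by linarith
  have "card \<G> > 0" using G by (simp add: card_gt_0_iff)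
  then have "card ?H \<noteq> 0" using half by linarith
  then show "?H \<noteq> {}" by (metis card.empty)
  show "spread (R / 2) ?H"
    unfolding spread_def
  proof (intro allI impI)
    fix T :: "'a set"
    assume T: "finite T"
    show "real (card {A \<in> ?H. T \<subseteq> A}) * (R / 2) ^ card T \<le> real (card ?H)"
    proof (cases "T = {}")
      case True
      then show ?thesis by simp
    next
      case False
      then have "(2::real) ^ 1 \<le> 2 ^ card T"
        using T by (intro power_increasing) (auto simp: Suc_le_eq card_gt_0_iff)
      then have two: "(2::real) \<le> 2 ^ card T" by simp
      have "real (card {A \<in> ?H. T \<subseteq> A}) * R ^ card T \<le> real (card {A \<in> \<G>. T \<subseteq> A}) * R ^ card T"
        using G R by (intro mult_right_mono of_nat_mono card_mono) auto
      also have "\<dots> \<le> real (card \<G>)" using spread T by (auto simp: spread_def)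
      also have "\<dots> \<le> 2 * real (card ?H)" by (rule half)
      also have "\<dots> \<le> 2 ^ card T * real (card ?H)" using two by (intro mult_right_mono) auto
      finally show ?thesis by (simp add: power_divide field_simps)
    qed
  qed
qed

section \<open>Links and the existence of homogeneous ones\<close>

lemma card_link: "card (link \<G> S) = card {A \<in> \<G>. S \<subseteq> A}"
proof -
  have "link \<G> S = (\<lambda>A. A - S) ` {A \<in> \<G>. S \<subseteq> A}" by (auto simp: link_def)
  moreover have "inj_on (\<lambda>A. A - S) {A \<in> \<G>. S \<subseteq> A}" by (auto simp: inj_on_def)
  ultimately show ?thesis by (simp add: card_image)
qed

lemma link_link_disjoint:
  assumes "B \<inter> S = {}"
  shows "link (link \<G> B) S = link \<G> (B \<union> S)"
proof
  show "link (link \<G> B) S \<subseteq> link \<G> (B \<union> S)"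
  proof
    fix x
    assume "x \<in> link (link \<G> B) S"
    then obtain A where "A \<in> \<G>" "B \<subseteq> A" "S \<subseteq> A - B" "x = (A - B) - S" by (auto simp: link_def)
    then have "A \<in> \<G> \<and> B \<union> S \<subseteq> A \<and> x = A - (B \<union> S)" by auto
    then show "x \<in> link \<G> (B \<union> S)" unfolding link_def by blast
  qed
  show "link \<G> (B \<union> S) \<subseteq> link (link \<G> B) S"
  proof
    fix x
    assume "x \<in> link \<G> (B \<union> S)"
    then obtain A where "A \<in> \<G>" "B \<union> S \<subseteq> A" "x = (A - B) - S" by (auto simp: link_def)
    then have "A - B \<in> link \<G> B" "S \<subseteq> A - B" using assms by (auto simp: link_def)
    then show "x \<in> link (link \<G> B) S" using \<open>x = (A - B) - S\<close> by (auto simp: link_def)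
  qed
qed

lemma link_link_not_disjoint: "B \<inter> S \<noteq> {} \<Longrightarrow> link (link \<G> B) S = {}"
  by (auto simp: link_def)

lemma link_eq_empty_iff: "link \<G> S = {} \<longleftrightarrow> (\<forall>A\<in>\<G>. \<not> S \<subseteq> A)"
  by (auto simp: link_def)

text \<open>Take \<open>S\<close> maximal with the density of \<open>\<G>\<close> over
  \<open>S\<close> at least \<open>\<tau> ^ card S\<close> times the expected one. A set
  \<open>U\<close> violating homogeneity of the link would make \<open>S \<union> U\<close> another
  such set. The last conclusion holds because the density of \<open>\<G>\<close> relative to
  \<open>\<B>\<close> over \<open>S\<close> is at most 1.\<close>

lemma ex_homogeneous_link:
  assumes fin: "finite \<B>" "\<And>A. A \<in> \<B> \<Longrightarrow> finite A" and sub: "\<G> \<subseteq> \<B>" "\<G> \<noteq> {}" and \<tau>: "\<tau> > 1"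
  obtains S A where "A \<in> \<G>" "S \<subseteq> A" "homogeneous (link \<B> S) \<tau> (link \<G> S)"
    "\<tau> ^ card S * real (card \<G>) \<le> real (card \<B>)"
proof -
  define f where "f = (\<lambda>S. real (card {A \<in> \<G>. S \<subseteq> A}))"
  define g where "g = (\<lambda>S. real (card {A \<in> \<B>. S \<subseteq> A}))"
  \<comment> \<open>The density condition is multiplied out. The first conjunct excludes sets
    contained in no member of \<open>\<B>\<close>, for which the inequality would read
    \<open>0 \<le> 0\<close>.\<close>
  define P where "P = {S. (\<exists>A\<in>\<G>. S \<subseteq> A) \<and> \<tau> ^ card S * real (card \<G>) * g S \<le> f S * real (card \<B>)}"
  have finG: "finite \<G>" using fin sub finite_subset by blast
  have "P \<subseteq> Pow (\<Union>\<B>)" using sub by (auto simp: P_def)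
  moreover have "finite (Pow (\<Union>\<B>))" using fin by simp
  ultimately have "finite P" by (rule finite_subset)
  moreover have "{} \<in> P" using sub by (auto simp: P_def f_def g_def)
  ultimately obtain S where S: "S \<in> P" "\<And>S'. S' \<in> P \<Longrightarrow> S \<subseteq> S' \<Longrightarrow> S = S'"
    using finite_has_maximal[of P] by blast
  then obtain A where A: "A \<in> \<G>" "S \<subseteq> A" by (auto simp: P_def)
  have finS: "finite S" using A fin sub finite_subset by blast
  have Bpos: "real (card \<B>) > 0" using fin sub by (auto simp: card_gt_0_iff)
  have fpos: "f S > 0" using A finG by (auto simp: f_def card_gt_0_iff)
  have fg: "f S \<le> g S" unfolding f_def g_def using fin sub by (intro of_nat_mono card_mono) auto
  have le: "\<tau> ^ card S * real (card \<G>) * g S \<le> f S * real (card \<B>)" using S by (simp add: P_def)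
  have main: "real (card (link (link \<G> S) U)) / real (card (link \<G> S))
      \<le> \<tau> ^ card U * (real (card (link (link \<B> S) U)) / real (card (link \<B> S)))" for U
  proof (cases "S \<inter> U = {} \<and> (\<exists>A\<in>\<G>. S \<union> U \<subseteq> A)")
    case False
    then have "link (link \<G> S) U = {}"
      by (metis link_eq_empty_iff link_link_disjoint link_link_not_disjoint)
    then show ?thesis using \<tau> by simp
  next
    case True
    then have disj: "S \<inter> U = {}" and ex: "\<exists>A\<in>\<G>. S \<union> U \<subseteq> A" by auto
    have finU: "finite U" using ex fin sub by (meson finite_subset le_supE subsetD)
    have "f (S \<union> U) * g S \<le> \<tau> ^ card U * g (S \<union> U) * f S"
    proof (cases "U = {}")
      case True
      then show ?thesis by simp
    next
      case False
      then have "S \<union> U \<notin> P" using S(2)[of "S \<union> U"] disj by blast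
      then have "f (S \<union> U) * real (card \<B>) \<le> \<tau> ^ card (S \<union> U) * real (card \<G>) * g (S \<union> U)"
        using ex by (auto simp: P_def)
      then have "f (S \<union> U) * real (card \<B>) * g S
          \<le> \<tau> ^ card (S \<union> U) * real (card \<G>) * g (S \<union> U) * g S"
        by (rule mult_right_mono) (simp add: g_def)
      also have "\<dots> = (\<tau> ^ card S * real (card \<G>) * g S) * (\<tau> ^ card U * g (S \<union> U))"
        using finS finU disj by (simp add: card_Un_disjoint power_add)
      also have "\<dots> \<le> (f S * real (card \<B>)) * (\<tau> ^ card U * g (S \<union> U))"
        using le \<tau> by (intro mult_right_mono) (auto simp: g_def)
      finally have "(f (S \<union> U) * g S) * real (card \<B>) \<le> (\<tau> ^ card U * g (S \<union> U) * f S) * real (card \<B>)"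
        by (simp add: mult_ac)
      then show ?thesis using Bpos by (rule mult_right_le_imp_le)
    qed
    then have "f (S \<union> U) / f S \<le> \<tau> ^ card U * (g (S \<union> U) / g S)"
      using fpos fg by (simp add: divide_simps mult_ac)
    then show ?thesis
      by (simp only: link_link_disjoint[OF disj] card_link f_def g_def)
  qed
  have "finite (link \<B> S)" using fin by (auto simp: link_def)
  then have hom: "homogeneous (link \<B> S) \<tau> (link \<G> S)"
    unfolding homogeneous_def using main \<tau> A sub by (auto simp: link_eq_empty_iff) (auto simp: link_def)
  have "\<tau> ^ card S * real (card \<G>) * g S \<le> real (card \<B>) * g S"
    using le fg Bpos by (smt (verit) mult.commute mult_left_mono)
  then have "\<tau> ^ card S * real (card \<G>) \<le> real (card \<B>)"
    using fpos fg by simp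
  with A hom that show thesis by blast
qed

section \<open>Factorial estimates\<close>

text \<open>A crude form of Stirling's bound: the induction step costs
  \<open>(1 + 1 / s) ^ s\<close>, which is at most \<open>exp 1\<close> and so at most 3.\<close>

lemma power_self_le_fact: "real s ^ s \<le> 3 ^ s * fact s"
proof (induction s)
  case 0
  then show ?case by simp
next
  case (Suc s)
  show ?case
  proof (cases "s = 0")
    case True
    then show ?thesis by simp
  next
    case False
    have "real (Suc s) ^ s = (1 + 1 / real s) ^ s * real s ^ s"
      using False by (simp add: field_simps flip: power_mult_distrib)
    also have "\<dots> \<le> 3 * real s ^ s"
    proof (rule mult_right_mono)
      have "(1 + 1 / real s) ^ s \<le> exp (1 / real s) ^ s"
        by (intro power_mono) auto
      also have "\<dots> = exp 1" using False by (simp flip: exp_of_nat_mult)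
      finally show "(1 + 1 / real s) ^ s \<le> 3" using exp_le by linarith
    qed simp
    also have "\<dots> \<le> 3 * (3 ^ s * fact s)" using Suc by simp
    finally have "real (Suc s) * real (Suc s) ^ s \<le> real (Suc s) * (3 * (3 ^ s * fact s))"
      by (intro mult_left_mono) auto
    then show ?thesis by (simp add: mult_ac)
  qed
qed

text \<open>Says that \<open>s\<close> further prescribed values are taken by at most a fraction
  \<open>(3 / m) ^ s\<close> of the permutations of \<open>m\<close> points. It combines
  \<open>(m / s) ^ s \<le> m choose s\<close> with the bound on \<open>s ^ s\<close>.\<close>

lemma power_fact_diff_le:
  assumes "s \<le> m"
  shows "real m ^ s * fact (m - s) \<le> 3 ^ s * fact m"
proof (cases "s = 0")
  case False
  have "(real m / real s) ^ s \<le> real (m choose s)"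
    using binomial_ge_n_over_k_pow_k[OF assms, where 'a=real] by simp
  then have "real m ^ s \<le> real (m choose s) * real s ^ s"
    using False by (simp add: power_divide field_simps)
  also have "\<dots> \<le> real (m choose s) * (3 ^ s * fact s)"
    using power_self_le_fact by (intro mult_left_mono) auto
  finally have "real m ^ s * fact (m - s) \<le> real (m choose s) * (3 ^ s * fact s) * fact (m - s)"
    by (rule mult_right_mono) simp
  also have "\<dots> = 3 ^ s * real (fact s * fact (m - s) * (m choose s))"
    by (simp add: mult_ac)
  also have "\<dots> = 3 ^ s * fact m"
    using binomial_fact_lemma[OF assms] by simp
  finally show ?thesis .
qed simp

section \<open>Counting permutations that extend a partial one\<close>

lemma inj_on_perm_graph: "inj_on (perm_graph n) {\<sigma>. \<sigma> permutes {1..n}}"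
proof (rule inj_onI, rule ext)
  fix \<sigma> \<pi> x
  assume p: "\<sigma> \<in> {\<sigma>. \<sigma> permutes {1..n}}" "\<pi> \<in> {\<sigma>. \<sigma> permutes {1..n}}"
    and eq: "perm_graph n \<sigma> = perm_graph n \<pi>"
  show "\<sigma> x = \<pi> x"
  proof (cases "x \<in> {1..n}")
    case True
    then have "(x, \<sigma> x) \<in> perm_graph n \<pi>" using eq by (auto simp: perm_graph_def)
    then show ?thesis by (auto simp: perm_graph_def)
  next
    case False
    then show ?thesis using p by (metis mem_Collect_eq permutes_not_in)
  qed
qed

lemma finite_perms: "finite (perms n)"
  by (simp add: perms_def finite_permutations)

lemma perms_memberD:
  assumes "A \<in> perms n"
  shows "A \<subseteq> {1..n} \<times> {1..n}" "finite A" "card A = n"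
proof -
  obtain \<sigma> where s: "\<sigma> permutes {1..n}" "A = perm_graph n \<sigma>" using assms by (auto simp: perms_def)
  have A: "A = (\<lambda>i. (i, \<sigma> i)) ` {1..n}" using s by (auto simp: perm_graph_def)
  show "A \<subseteq> {1..n} \<times> {1..n}" unfolding A using permutes_in_image[OF s(1)] by blast
  show "finite A" by (simp add: A)
  show "card A = n" by (simp add: A card_image inj_on_def)
qed

text \<open>Composing with the inverse of one extension \<open>\<sigma>\<close> turns the extensions
  of \<open>P\<close> into the permutations that fix the domain \<open>D\<close> of \<open>P\<close>
  pointwise.\<close>

lemma card_perms_containing:
  assumes "partial_perm n P"
  shows "card {A \<in> perms n. P \<subseteq> A} = fact (n - card P)" and "card P \<le> n"
proof -
  obtain \<sigma> where s: "\<sigma> permutes {1..n}" and P: "P \<subseteq> perm_graph n \<sigma>"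
    using assms by (auto simp: partial_perm_def perms_def)
  define D where "D = fst ` P"
  have D: "D \<subseteq> {1..n}" using P by (auto simp: D_def perm_graph_def)
  have "inj_on fst (perm_graph n \<sigma>)" by (auto simp: inj_on_def perm_graph_def)
  then have "inj_on fst P" using P by (rule inj_on_subset)
  then have cD: "card D = card P" by (simp add: D_def card_image)
  show "card P \<le> n" using card_mono[OF _ D] cD by simp
  have Peq: "P = {(i, \<sigma> i) | i. i \<in> D}" using P by (force simp: D_def perm_graph_def)
  have sub: "P \<subseteq> perm_graph n \<pi> \<longleftrightarrow> (\<forall>i\<in>D. \<pi> i = \<sigma> i)" for \<pi>
    using D by (subst Peq) (auto simp: perm_graph_def)
  let ?E = "{\<pi>. \<pi> permutes {1..n} \<and> (\<forall>i\<in>D. \<pi> i = \<sigma> i)}"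
  have "?E = (\<lambda>\<tau>. \<sigma> \<circ> \<tau>) ` {\<tau>. \<tau> permutes {1..n} - D}"
  proof (intro equalityI subsetI)
    fix \<pi> assume p: "\<pi> \<in> ?E"
    have "inv \<sigma> \<circ> \<pi> permutes {1..n}"
      using p s by (intro permutes_compose permutes_inv) auto
    moreover have "(inv \<sigma> \<circ> \<pi>) x = x" if "x \<in> D" for x
      using that p permutes_inverses(2)[OF s] by simp
    ultimately have "inv \<sigma> \<circ> \<pi> permutes {1..n} - D"
      by (rule permutes_superset) blast
    moreover have "\<pi> = \<sigma> \<circ> (inv \<sigma> \<circ> \<pi>)" using permutes_inverses(1)[OF s] by (auto simp: o_def)
    ultimately show "\<pi> \<in> (\<lambda>\<tau>. \<sigma> \<circ> \<tau>) ` {\<tau>. \<tau> permutes {1..n} - D}" by blast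
  next
    fix \<pi> assume "\<pi> \<in> (\<lambda>\<tau>. \<sigma> \<circ> \<tau>) ` {\<tau>. \<tau> permutes {1..n} - D}"
    then obtain \<tau> where t: "\<tau> permutes {1..n} - D" "\<pi> = \<sigma> \<circ> \<tau>" by auto
    have "\<tau> permutes {1..n}" using t(1) by (rule permutes_subset) auto
    then have "\<pi> permutes {1..n}" unfolding t(2) using s by (rule permutes_compose)
    moreover have "\<pi> i = \<sigma> i" if "i \<in> D" for i using that t by (simp add: permutes_not_in)
    ultimately show "\<pi> \<in> ?E" by simp
  qed
  moreover have "inj_on (\<lambda>\<tau>. \<sigma> \<circ> \<tau>) {\<tau>. \<tau> permutes {1..n} - D}"
    using permutes_inj[OF s] by (auto simp: inj_on_def fun_eq_iff dest: injD)
  ultimately have "card ?E = card {\<tau>. \<tau> permutes {1..n} - D}" by (simp add: card_image)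
  also have "\<dots> = fact (n - card P)"
    using D cD by (intro card_permutations) (auto simp: card_Diff_subset finite_subset)
  finally have E: "card ?E = fact (n - card P)" .
  have "{A \<in> perms n. P \<subseteq> A} = perm_graph n ` ?E" using sub by (auto simp: perms_def)
  moreover have "inj_on (perm_graph n) ?E" using inj_on_perm_graph by (rule inj_on_subset) auto
  ultimately show "card {A \<in> perms n. P \<subseteq> A} = fact (n - card P)" using E by (simp add: card_image)
qed

text \<open>The divisor 6 is the product of the homogeneity constant 2 and the constant 3 of the
  factorial estimate, applied with \<open>m = n - card B\<close>.\<close>

lemma homogeneous_imp_spread:
  assumes B: "partial_perm n B" and hom: "homogeneous (link (perms n) B) 2 \<G>"
  shows "spread ((real n - real (card B)) / 6) \<G>"
  unfolding spread_def
proof (intro allI impI)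
  fix T :: "(nat \<times> nat) set"
  assume T: "finite T"
  define m where "m = n - card B"
  have m: "real n - real (card B) = real m" using card_perms_containing(2)[OF B] by (simp add: m_def)
  have fin: "finite \<G>" and sub: "\<G> \<subseteq> link (perms n) B" and ne: "\<G> \<noteq> {}"
    using hom finite_subset by (auto simp: homogeneous_def)
  then have pos: "real (card \<G>) > 0" by (simp add: card_gt_0_iff)
  show "real (card {A \<in> \<G>. T \<subseteq> A}) * ((real n - real (card B)) / 6) ^ card T \<le> real (card \<G>)"
  proof (cases "B \<inter> T = {} \<and> partial_perm n (B \<union> T)")
    \<comment> \<open>No permutation containing \<open>B\<close> has a link member containing
      \<open>T\<close>, so the count is 0.\<close>
    case False
    then have "link (link (perms n) B) T = {}"
      by (metis link_eq_empty_iff link_link_disjoint link_link_not_disjoint partial_perm_def)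
    then have "{A \<in> \<G>. T \<subseteq> A} = {}" using sub by (auto simp: link_eq_empty_iff)
    then show ?thesis by (metis card.empty mult_zero_left of_nat_0 of_nat_0_le_iff)
  next
    case True
    have finB: "finite B" using B perms_memberD(2) finite_subset by (metis partial_perm_def)
    have c: "card (B \<union> T) = card B + card T" using True finB T by (simp add: card_Un_disjoint)
    have s: "card T \<le> m" using card_perms_containing(2)[of n "B \<union> T"] True c by (simp add: m_def)
    have "real (card (link \<G> T)) / real (card \<G>) \<le> 2 ^ card T *
        (real (card (link (link (perms n) B) T)) / real (card (link (perms n) B)))"
      using hom by (simp add: homogeneous_def)
    also have "\<dots> = 2 ^ card T * (fact (m - card T) / fact m)"
      using True card_perms_containing(1)[OF B] card_perms_containing(1)[of n "B \<union> T"] c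
      by (simp add: link_link_disjoint card_link m_def)
    finally have le: "real (card {A \<in> \<G>. T \<subseteq> A}) * fact m \<le> 2 ^ card T * fact (m - card T) * real (card \<G>)"
      using pos by (simp add: card_link field_simps)
    then have "real m ^ card T * (real (card {A \<in> \<G>. T \<subseteq> A}) * fact m)
        \<le> real m ^ card T * (2 ^ card T * fact (m - card T) * real (card \<G>))"
      by (intro mult_left_mono) auto
    also have "\<dots> = 2 ^ card T * real (card \<G>) * (real m ^ card T * fact (m - card T))"
      by (simp add: mult_ac)
    also have "\<dots> \<le> 2 ^ card T * real (card \<G>) * (3 ^ card T * fact m)"
      using power_fact_diff_le[OF s] by (intro mult_left_mono) auto
    also have "\<dots> = (2 * 3) ^ card T * real (card \<G>) * fact m"
      by (simp only: power_mult_distrib mult_ac)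
    finally have "(real m ^ card T * real (card {A \<in> \<G>. T \<subseteq> A})) * fact m \<le> (6 ^ card T * real (card \<G>)) * fact m"
      by (simp add: mult_ac)
    then have "real m ^ card T * real (card {A \<in> \<G>. T \<subseteq> A}) \<le> 6 ^ card T * real (card \<G>)"
      by (rule mult_right_le_imp_le) simp
    then show ?thesis unfolding m by (simp add: power_divide field_simps)
  qed
qed

section \<open>Choosing the number of halving steps\<close>

lemma square_le_power2:
  assumes "19 \<le> L"
  shows "256 * L ^ 2 \<le> (2::nat) ^ (L - 1)"
  using assms
proof (induction L rule: dec_induct)
  case base
  then show ?case by simp
next
  case (step L)
  have "(Suc L) ^ 2 \<le> 2 * L ^ 2"
  proof -
    have "2 * L + 1 \<le> 19 * L" using step by simp
    also have "\<dots> \<le> L * L" using step by simp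
    finally show ?thesis by (simp add: power2_eq_square)
  qed
  then have "256 * (Suc L) ^ 2 \<le> 2 * (256 * L ^ 2)" by simp
  also have "\<dots> \<le> 2 * 2 ^ (L - 1)" using step by simp
  also have "\<dots> = 2 ^ (Suc L - 1)" using step by (cases L) auto
  finally show ?case .
qed

text \<open>For the least \<open>L\<close> with \<open>n < 2 ^ L\<close>, minimality gives
  \<open>2 ^ (L - 1) \<le> n\<close>, and \<open>n > 2 ^ 18\<close> forces
  \<open>L \<ge> 19\<close>, where the exponential exceeds \<open>256 * L ^ 2\<close>. The constant
  256 makes \<open>n / 16\<close> reach the spreadness \<open>16 * L ^ 2\<close> asked for by
  disjoint members.\<close>

lemma ex_halving_depth:
  assumes "n > 2 ^ 18"
  obtains L where "n < 2 ^ L" "256 * L ^ 2 \<le> n" "L > 0"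
proof -
  define L where "L = (LEAST L. n < 2 ^ L)"
  have L: "n < 2 ^ L" unfolding L_def by (rule LeastI[of _ n]) simp
  have "18 < L"
  proof (rule ccontr)
    assume "\<not> 18 < L"
    then have "(2::nat) ^ L \<le> 2 ^ 18" by (intro power_increasing) auto
    then show False using L assms by linarith
  qed
  moreover have "2 ^ (L - 1) \<le> n"
    using not_less_Least[of "L - 1" "\<lambda>L. n < 2 ^ L"] \<open>18 < L\<close> by (simp flip: L_def)
  moreover have "256 * L ^ 2 \<le> 2 ^ (L - 1)" using \<open>18 < L\<close> by (intro square_le_power2) simp
  ultimately show thesis using L by (intro that[of L]) auto
qed

section \<open>The intersection property and the theorem\<close>

text \<open>Each link is thinned to the members that avoid the other centre. Disjoint members
  \<open>C\<close>, \<open>C'\<close> of the two thinned links extend to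
  \<open>A = B \<union> C\<close> and \<open>A' = B' \<union> C'\<close>, and three of the four
  cross intersections are empty.\<close>

lemma ex_members_meeting_only_in_centres:
  assumes n: "n > 2 ^ 18" and B: "partial_perm n B" "partial_perm n B'"
    and small: "16 * card B \<le> n" "16 * card B' \<le> n"
    and hom: "homogeneous (link (perms n) B) 2 (link \<F> B)"
      "homogeneous (link (perms n) B') 2 (link \<F>' B')"
  obtains A A' where "A \<in> \<F>" "A' \<in> \<F>'" "A \<inter> A' = B \<inter> B'"
proof -
  obtain L where L: "n < 2 ^ L" "256 * L ^ 2 \<le> n" "L > 0" using n by (rule ex_halving_depth)
  have *: "{A \<in> link \<F> B. A \<inter> B' = {}} \<noteq> {}" "spread (real n / 16) {A \<in> link \<F> B. A \<inter> B' = {}}"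
      "{A \<in> link \<F> B. A \<inter> B' = {}} \<subseteq> Pow ({1..n} \<times> {1..n})"
      "\<And>A. A \<in> link \<F> B \<Longrightarrow> card A < 2 ^ L"
    if B: "partial_perm n B" "partial_perm n B'" and small: "16 * card B \<le> n" "16 * card B' \<le> n"
      and hom: "homogeneous (link (perms n) B) 2 (link \<F> B)" for \<F> B B'
  proof -
    have fin: "finite (link \<F> B)" and sub: "link \<F> B \<subseteq> link (perms n) B" and ne: "link \<F> B \<noteq> {}"
      using hom finite_subset by (auto simp: homogeneous_def)
    have "real (16 * card B) \<le> real n" using small(1) by (rule of_nat_mono)
    \<comment> \<open>As \<open>card B \<le> n / 16\<close>, the spreadness
      \<open>(n - card B) / 6\<close> is at least \<open>15 * n / 96\<close>, which exceeds
      \<open>n / 8\<close>. Avoiding \<open>B'\<close> then halves \<open>n / 8\<close>.\<close>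
    then have "spread (real n / 8) (link \<F> B)"
      using homogeneous_imp_spread[OF B(1) hom] by (rule_tac spread_mono) auto
    moreover have "2 * real (card B') \<le> real n / 8"
      using of_nat_mono[OF small(2), where 'a=real] by simp
    moreover have "finite B'" using B(2) perms_memberD(2) finite_subset by (metis partial_perm_def)
    ultimately show "{A \<in> link \<F> B. A \<inter> B' = {}} \<noteq> {}"
        "spread (real n / 16) {A \<in> link \<F> B. A \<inter> B' = {}}"
      using spread_avoiding[OF fin ne, of "real n / 8" B'] n by auto
    have mem: "A \<subseteq> {1..n} \<times> {1..n} \<and> card A < 2 ^ L" if A: "A \<in> link \<F> B" for A
    proof -
      obtain A0 where A0: "A0 \<in> perms n" "A \<subseteq> A0" using subsetD[OF sub A] by (auto simp: link_def)
      have "card A \<le> n" using card_mono[OF _ A0(2)] perms_memberD[OF A0(1)] by simp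
      then show ?thesis using A0 perms_memberD(1)[OF A0(1)] L(1) by auto
    qed
    show "{A \<in> link \<F> B. A \<inter> B' = {}} \<subseteq> Pow ({1..n} \<times> {1..n})"
      "\<And>A. A \<in> link \<F> B \<Longrightarrow> card A < 2 ^ L"
      using mem by auto
  qed
  let ?\<G> = "{A \<in> link \<F> B. A \<inter> B' = {}}" and ?\<H> = "{A \<in> link \<F>' B'. A \<inter> B = {}}"
  note G = *[OF B small hom(1)] and H = *[OF B(2,1) small(2,1) hom(2)]
  have R: "real n / 16 \<ge> 16 * real L ^ 2"
    using of_nat_mono[OF L(2), where 'a=real] by simp
  have size: "card A < 2 ^ L" if "A \<in> ?\<G> \<union> ?\<H>" for A
    using that G(4) H(4) by auto
  obtain C C' where "C \<in> ?\<G>" "C' \<in> ?\<H>" and CC: "C \<inter> C' = {}"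
    by (rule spread_families_disjoint_members[of "{1..n} \<times> {1..n}" ?\<G> ?\<H> L, OF _ _ _ _ _ size L(3) R])
      (use G(1-3) H(1-3) in simp_all)
  then have C: "C \<in> link \<F> B" "C \<inter> B' = {}" "C' \<in> link \<F>' B'" "C' \<inter> B = {}" by simp_all
  from C(1) obtain A where A: "A \<in> \<F>" "B \<subseteq> A" "C = A - B" by (auto simp: link_def)
  from C(3) obtain A' where A': "A' \<in> \<F>'" "B' \<subseteq> A'" "C' = A' - B'"
    by (auto simp: link_def)
  have "A \<inter> A' = B \<inter> B'" using A(2,3) A'(2,3) C(2,4) CC by blast
  with A(1) A'(1) show thesis by (rule that)
qed

theorem theorem8:
  fixes n t :: nat and q :: real and \<F> :: "(nat \<times> nat) set set"
  assumes "n \<ge> 1" and "t \<ge> 1"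
    and "n > 2 ^ 18"
    and "real t \<le> real n / (64 * log 2 (real n))"
    and "\<F> \<subseteq> perms n"
    and "t_intersecting t \<F>"
    and "q = 4 * real t * log 2 (real n)"
  shows "\<exists>\<S> \<F>'.
      t_intersecting t \<S>
    \<and> (\<forall>B\<in>\<S>. partial_perm n B \<and> real (card B) \<le> q)
    \<and> \<F>' \<subseteq> \<F>
    \<and> (\<forall>A\<in>\<F> - \<F>'. \<exists>B\<in>\<S>. B \<subseteq> A)
    \<and> (\<forall>B\<in>\<S>. \<exists>\<F>\<^sub>B. \<F>\<^sub>B \<subseteq> \<F> \<and> homogeneous (link (perms n) B) 2 (link \<F>\<^sub>B B))
    \<and> real (card \<F>') \<le> real n powr (- 4 * real t) * fact n"
proof -
  define \<S> where "\<S> = {B. partial_perm n B \<and> real (card B) \<le> q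
    \<and> (\<exists>\<F>\<^sub>B. \<F>\<^sub>B \<subseteq> \<F> \<and> homogeneous (link (perms n) B) 2 (link \<F>\<^sub>B B))}"
  define \<F>' where "\<F>' = {A \<in> \<F>. \<forall>B\<in>\<S>. \<not> B \<subseteq> A}"
  have logpos: "log 2 (real n) > 0" using assms(3) by simp
  \<comment> \<open>The constant 64 in the bound on \<open>t\<close> is 4 from \<open>q\<close>
    times the 16 of the size condition on centres.\<close>
  have q16: "q \<le> real n / 16"
    using assms(4) logpos unfolding assms(7) by (simp add: field_simps)
  have intersecting: "t_intersecting t \<S>"
    unfolding t_intersecting_def
  proof (intro ballI)
    fix B B'
    assume B: "B \<in> \<S>" "B' \<in> \<S>"
    then obtain \<H> \<H>' where H: "\<H> \<subseteq> \<F>" "homogeneous (link (perms n) B) 2 (link \<H> B)"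
        "\<H>' \<subseteq> \<F>" "homogeneous (link (perms n) B') 2 (link \<H>' B')"
      by (auto simp: \<S>_def)
    have pp: "partial_perm n B" "partial_perm n B'" using B by (auto simp: \<S>_def)
    have "real (16 * card B) \<le> real n" "real (16 * card B') \<le> real n"
      using B q16 by (auto simp: \<S>_def)
    then have small: "16 * card B \<le> n" "16 * card B' \<le> n" by (simp_all only: of_nat_le_iff)
    \<comment> \<open>Both members belong to \<open>\<F>\<close>, so their intersection has at least
      \<open>t\<close> elements. The case \<open>B = B'\<close> is included and gives
      \<open>t \<le> card B\<close>.\<close>
    obtain A A' where "A \<in> \<H>" "A' \<in> \<H>'" "A \<inter> A' = B \<inter> B'"
      using ex_members_meeting_only_in_centres[OF assms(3) pp small H(2,4)] by blast
    then show "t \<le> card (B \<inter> B')" using assms(6) H by (metis subsetD t_intersecting_def)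
  qed
  have card: "real (card \<F>') \<le> real n powr (- 4 * real t) * fact n"
  proof (cases "\<F>' = {}")
    case False
    have sub: "\<F>' \<subseteq> perms n" using assms(5) by (auto simp: \<F>'_def)
    obtain S A where S: "A \<in> \<F>'" "S \<subseteq> A" "homogeneous (link (perms n) S) 2 (link \<F>' S)"
        "2 ^ card S * real (card \<F>') \<le> real (card (perms n))"
      by (rule ex_homogeneous_link[OF finite_perms perms_memberD(2) sub False]) auto
    have pp: "partial_perm n S" using S sub by (auto simp: partial_perm_def)
    \<comment> \<open>\<open>S\<close> lies in \<open>A\<close>, a member of \<open>\<F>'\<close>.
      Since \<open>\<F>'\<close> itself serves as the family for \<open>S\<close>, only the size
      condition can fail.\<close>
    have "S \<notin> \<S>" using S by (auto simp: \<F>'_def)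
    then have large: "q < real (card S)" using S pp by (auto simp: \<S>_def \<F>'_def)
    have "partial_perm n {}" using pp by (auto simp: partial_perm_def)
    then have cn: "card (perms n) = fact n" using card_perms_containing(1)[of n "{}"] by simp
    have "real n powr (4 * real t) = 2 powr q"
      using assms(3) unfolding assms(7) by (simp add: powr_powr[symmetric] mult.commute)
    also have "\<dots> \<le> 2 powr real (card S)" using large by (intro powr_mono) auto
    finally have "real n powr (4 * real t) * real (card \<F>') \<le> 2 ^ card S * real (card \<F>')"
      by (intro mult_right_mono) (auto simp: powr_realpow)
    also have "\<dots> \<le> fact n" using S(4) cn by simp
    finally show ?thesis using assms(3) by (simp add: powr_minus field_simps)
  qed simp
  have small: "\<forall>B\<in>\<S>. partial_perm n B \<and> real (card B) \<le> q"
    and hom: "\<forall>B\<in>\<S>. \<exists>\<F>\<^sub>B. \<F>\<^sub>B \<subseteq> \<F> \<and> homogeneous (link (perms n) B) 2 (link \<F>\<^sub>B B)"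
    by (simp_all add: \<S>_def)
  have sub: "\<F>' \<subseteq> \<F>" and contain: "\<forall>A\<in>\<F> - \<F>'. \<exists>B\<in>\<S>. B \<subseteq> A"
    by (auto simp: \<F>'_def)
  show ?thesis
    by (rule exI[of _ \<S>], rule exI[of _ \<F>'], intro conjI)
      (rule intersecting small sub contain hom card)+
qed

end
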